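(* Assume rewards lie in $[0,1]$ and the user-task distribution is agent-independent. Fix a threshold $\delta>0$. On the event $\mathcal E_L$, if some $\tau>0$ satisfies $(\tau,\delta)\in\mathcal R$, where $$\mathcal R=\bigl\{(\tau,\delta)\in\mathbb R_{>0}^2:\ (1-\widehat Z_k+\varepsilon_Z)(\delta+\varepsilon_D)+\varepsilon_L<\tau\le\Theta_k\bigr\},\qquad \Theta_k=\min\{\widehat Z_k,\ Z_k\bar a_k+\varepsilon_L\},$$ then, with $\varepsilon_\Sigma=2\varepsilon_V+\varepsilon_R+\varepsilon_Z$, $$J_{\mathrm{user}}(A_k)<1-(1-Z_k)\delta-\varepsilon_\Sigma .$$
   Context: Tasks $\mathcal T_{\mathrm{user}}$ and outputs $\mathcal O$ are measurable spaces; an agent is a Markov kernel $A(\cdot\mid t)$ from tasks to outputs; reward $r(t,o)\in[0,1]$ and failure detector $\phi(t,o)\in\{0,1\}$ are measurable; $\mathcal D_{\mathrm{user}}$ is a fixed probability measure on tasks. $V(A,t)=\int r(t,o)A(do\mid t)$, $J_{\mathrm{user}}(A)=\mathbb E_{t\sim\mathcal D_{\mathrm{user}}}V(A,t)$, $\psi_A(t)=\int\phi(t,o)A(do\mid t)$, $Z_k=\mathbb E_{\mathcal D_{\mathrm{user}}}\psi_{A_k}\in(0,1)$, $\mathcal D_{F,k}(dt)=\frac{\psi_{A_k}(t)}{Z_k}\mathcal D_{\mathrm{user}}(dt)$. $\bar a_k=1-\mathbb E_{t\sim\mathcal D_{F,k}}[V(A_k,t)]$. Evaluation data for the current agent $A_k$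 and a candidate $\widetilde A$: a stored sample $(t_j^R,\phi_j^R)_{j\le n_R}$ with labels $\phi_j^R\in\{0,1\}$, $\widehat Z_k=\frac1{n_R}\sum_j\phi_j^R$; a returned batch of failure tasks $t_1^F,\dots,t_{n_F}^F$; and for each evaluation task and each of the two agents an average $\hat V(A,t)\in[0,1]$ of $m$ fresh rollout rewards. Positive error radii: $\varepsilon_V$ (per-task reward estimates), $\varepsilon_Z$ (failure rate), $\varepsilon_R$ (retained-task statistic), $\varepsilon_F$ (failure-batch mean); with $\varepsilon_L=\varepsilon_Z+(\widehat Z_k+\varepsilon_Z)(2\varepsilon_V+\varepsilon_F)$ and $\varepsilon_D=\varepsilon_\Sigma/(1-\widehat Z_k)$. $\mathcal E_L$ is the event that the required samples are available, including at least one stored label equal to $0$ (so $\widehat Z_k<1$), and that $|\widehat Z_k-Z_k|\le\varepsilon_Z$, $|\hat V(A,t_i^F)-V(A,t_i^F)|\le\varepsilon_V$ for all $i$ and $A\in\{A_k,\widetilde A\}$, and $\bigl|\frac1{n_F}\sum_i[V(\widetilde A,t_i^F)-V(A_k,t_i^F)]-\mathbb E_{\mathcal D_{F,k}}[V(\widetilde A,t)-V(A_k,t)]\bigr|\le\varepsilon_F$. *)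

theory Defs
  imports "HOL-Probability.Probability"
begin

text \<open>
  An agent is a Markov kernel from the task space \<open>T\<close> to the output space \<open>Out\<close>, i.e. an element of
  \<open>T \<rightarrow>\<^sub>M prob_algebra Out\<close>.  Rewards and detectors are curried functions of task and output.
\<close>

type_synonym ('t, 'o) agent = "'t \<Rightarrow> 'o measure"

definition task_value :: "('t \<Rightarrow> 'o \<Rightarrow> real) \<Rightarrow> ('t, 'o) agent \<Rightarrow> 't \<Rightarrow> real" where
  "task_value r A t = (\<integral>y. r t y \<partial>A t)"

definition J_user :: "'t measure \<Rightarrow> ('t \<Rightarrow> 'o \<Rightarrow> real) \<Rightarrow> ('t, 'o) agent \<Rightarrow> real" where
  "J_user D r A = (\<integral>t. task_value r A t \<partial>D)"

definition fail_prob :: "('t \<Rightarrow> 'o \<Rightarrow> real) \<Rightarrow> ('t, 'o) agent \<Rightarrow> 't \<Rightarrow> real" where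
  "fail_prob \<phi> A t = (\<integral>y. \<phi> t y \<partial>A t)"

definition fail_rate :: "'t measure \<Rightarrow> ('t \<Rightarrow> 'o \<Rightarrow> real) \<Rightarrow> ('t, 'o) agent \<Rightarrow> real" where
  "fail_rate D \<phi> A = (\<integral>t. fail_prob \<phi> A t \<partial>D)"

definition fail_dist :: "'t measure \<Rightarrow> ('t \<Rightarrow> 'o \<Rightarrow> real) \<Rightarrow> ('t, 'o) agent \<Rightarrow> 't measure" where
  "fail_dist D \<phi> A = density D (\<lambda>t. ennreal (fail_prob \<phi> A t / fail_rate D \<phi> A))"

definition mean_gap ::
  "'t measure \<Rightarrow> ('t \<Rightarrow> 'o \<Rightarrow> real) \<Rightarrow> ('t \<Rightarrow> 'o \<Rightarrow> real) \<Rightarrow> ('t, 'o) agent \<Rightarrow> real" where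
  "mean_gap D r \<phi> A = 1 - (\<integral>t. task_value r A t \<partial>fail_dist D \<phi> A)"

text \<open>
  Evaluation data are random variables on a sample space with points \<open>w\<close>.  The numbers \<open>nR w\<close> of
  stored labels and \<open>nF w\<close> of returned failure tasks may be random; indices start at \<open>0\<close>, and
  entries with index beyond these numbers are never used.  \<open>Y i l w\<close> is the output of the \<open>l\<close>-th
  rollout of an agent on the \<open>i\<close>-th failure task \<open>tF i w\<close>.
\<close>

definition Z_hat :: "('w \<Rightarrow> nat) \<Rightarrow> (nat \<Rightarrow> 'w \<Rightarrow> real) \<Rightarrow> 'w \<Rightarrow> real" where
  "Z_hat nR \<phi>R w = (\<Sum>j<nR w. \<phi>R j w) / real (nR w)"

definition V_hat ::
  "('t \<Rightarrow> 'o \<Rightarrow> real) \<Rightarrow> nat \<Rightarrow> (nat \<Rightarrow> 'w \<Rightarrow> 't) \<Rightarrow> (nat \<Rightarrow> nat \<Rightarrow> 'w \<Rightarrow> 'o) \<Rightarrow> nat \<Rightarrow> 'w \<Rightarrow> real" where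
  "V_hat r m tF Y i w = (\<Sum>l<m. r (tF i w) (Y i l w)) / real m"

text \<open>
  In the event below, \<open>Ak\<close> and \<open>At\<close> are the current and the candidate agent, with rollouts \<open>Yk\<close> and
  \<open>Yt\<close>.  The first three conditions say that the required samples are available.
\<close>

definition event_L ::
  "'w measure \<Rightarrow> 't measure \<Rightarrow> ('t \<Rightarrow> 'o \<Rightarrow> real) \<Rightarrow> ('t \<Rightarrow> 'o \<Rightarrow> real) \<Rightarrow>
   ('t, 'o) agent \<Rightarrow> ('t, 'o) agent \<Rightarrow>
   ('w \<Rightarrow> nat) \<Rightarrow> (nat \<Rightarrow> 'w \<Rightarrow> real) \<Rightarrow>
   ('w \<Rightarrow> nat) \<Rightarrow> (nat \<Rightarrow> 'w \<Rightarrow> 't) \<Rightarrow>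
   nat \<Rightarrow> (nat \<Rightarrow> nat \<Rightarrow> 'w \<Rightarrow> 'o) \<Rightarrow> (nat \<Rightarrow> nat \<Rightarrow> 'w \<Rightarrow> 'o) \<Rightarrow>
   real \<Rightarrow> real \<Rightarrow> real \<Rightarrow> 'w set" where
  "event_L M D r \<phi> Ak At nR \<phi>R nF tF m Yk Yt \<epsilon>V \<epsilon>Z \<epsilon>F =
    {w \<in> space M.
       0 < nR w \<and> 0 < nF w \<and>
       (\<exists>j<nR w. \<phi>R j w = 0) \<and>
       \<bar>Z_hat nR \<phi>R w - fail_rate D \<phi> Ak\<bar> \<le> \<epsilon>Z \<and>
       (\<forall>i<nF w. \<forall>(A, Y) \<in> {(Ak, Yk), (At, Yt)}.
          \<bar>V_hat r m tF Y i w - task_value r A (tF i w)\<bar> \<le> \<epsilon>V) \<and>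
       \<bar>(\<Sum>i<nF w. task_value r At (tF i w) - task_value r Ak (tF i w)) / real (nF w)
         - (\<integral>t. (task_value r At t - task_value r Ak t) \<partial>fail_dist D \<phi> Ak)\<bar> \<le> \<epsilon>F}"

definition eps_L :: "real \<Rightarrow> real \<Rightarrow> real \<Rightarrow> real \<Rightarrow> real" where
  "eps_L Zh \<epsilon>V \<epsilon>Z \<epsilon>F = \<epsilon>Z + (Zh + \<epsilon>Z) * (2 * \<epsilon>V + \<epsilon>F)"

definition eps_Sigma :: "real \<Rightarrow> real \<Rightarrow> real \<Rightarrow> real" where
  "eps_Sigma \<epsilon>V \<epsilon>Z \<epsilon>R = 2 * \<epsilon>V + \<epsilon>R + \<epsilon>Z"

definition eps_D :: "real \<Rightarrow> real \<Rightarrow> real \<Rightarrow> real \<Rightarrow> real" where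
  "eps_D Zh \<epsilon>V \<epsilon>Z \<epsilon>R = eps_Sigma \<epsilon>V \<epsilon>Z \<epsilon>R / (1 - Zh)"

text \<open>
  In the next two definitions \<open>Zh\<close> is the observed failure rate, \<open>Z\<close> the true one and \<open>a\<close> the mean
  gap of the current agent.
\<close>

definition Theta :: "real \<Rightarrow> real \<Rightarrow> real \<Rightarrow> real \<Rightarrow> real \<Rightarrow> real \<Rightarrow> real" where
  "Theta Zh Z a \<epsilon>V \<epsilon>Z \<epsilon>F = min Zh (Z * a + eps_L Zh \<epsilon>V \<epsilon>Z \<epsilon>F)"

definition feasible ::
  "real \<Rightarrow> real \<Rightarrow> real \<Rightarrow> real \<Rightarrow> real \<Rightarrow> real \<Rightarrow> real \<Rightarrow> (real \<times> real) set" where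
  "feasible Zh Z a \<epsilon>V \<epsilon>Z \<epsilon>R \<epsilon>F =
    {(\<tau>, \<delta>). 0 < \<tau> \<and> 0 < \<delta> \<and>
       (1 - Zh + \<epsilon>Z) * (\<delta> + eps_D Zh \<epsilon>V \<epsilon>Z \<epsilon>R) + eps_L Zh \<epsilon>V \<epsilon>Z \<epsilon>F < \<tau> \<and>
       \<tau> \<le> Theta Zh Z a \<epsilon>V \<epsilon>Z \<epsilon>F}"

end

theory Submission
  imports Defs
begin

text \<open>
  A task fails with probability at most one, so
  \<open>1 - J = E[1 - V] \<ge> E[\<psi> (1 - V)] = Z a\<close>, the mass of the loss that sits on the failure
  distribution.  Feasibility of \<open>\<tau>\<close> bounds \<open>Z a\<close> strictly from below by
  \<open>(1 - Zh + \<epsilon>Z) (\<delta> + \<epsilon>D)\<close>, and there \<open>1 - Zh + \<epsilon>Z \<ge> 1 - Z\<close> multiplies \<open>\<delta>\<close> while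
  \<open>(1 - Zh) \<epsilon>D = \<epsilon>\<Sigma>\<close>.
\<close>

text \<open>The integrand depends on \<open>t\<close> along with the measure. Pushing
  \<open>A t\<close> forward along \<open>Pair t\<close> moves this dependence into the measure: a
  fixed function on the product is integrated against a kernel, where measurability in
  \<open>t\<close> is a library fact.\<close>

lemma kernel_integral_measurable:
  fixes f :: "'t \<Rightarrow> 'o \<Rightarrow> real"
  assumes A: "A \<in> T \<rightarrow>\<^sub>M prob_algebra Out"
    and f: "case_prod f \<in> borel_measurable (T \<Otimes>\<^sub>M Out)"
  shows "(\<lambda>t. \<integral>y. f t y \<partial>A t) \<in> borel_measurable T"
proof -
  note [measurable] = f measurable_prob_algebraD[OF A] measurable_distr2
  have "(\<lambda>t. integral\<^sup>L (distr (A t) (T \<Otimes>\<^sub>M Out) (Pair t)) (case_prod f)) \<in> borel_measurable T"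
    by measurable
  also have "?this \<longleftrightarrow> ?thesis"
  \<comment> \<open>The change of variables holds only for \<open>t\<close> in
    \<open>space T\<close>, where \<open>A t\<close> carries the sigma-algebra of \<open>Out\<close>
    and \<open>Pair t\<close> is measurable.\<close>
  proof (rule measurable_cong)
    fix t assume t: "t \<in> space T"
    then have "sets (A t) = sets Out"
      using measurable_space[OF A t] by (simp add: space_prob_algebra)
    then have "Pair t \<in> A t \<rightarrow>\<^sub>M T \<Otimes>\<^sub>M Out"
      using t by (simp cong: measurable_cong_sets)
    then show "integral\<^sup>L (distr (A t) (T \<Otimes>\<^sub>M Out) (Pair t)) (case_prod f) = (\<integral>y. f t y \<partial>A t)"
      by (simp only: integral_distr[OF _ f] prod.case)
  qed
  finally show ?thesis .
qed

text \<open>Averaging against a probability measure keeps values in the unit interval. This serves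
  both \<open>task_value\<close> and \<open>fail_prob\<close>.\<close>

lemma kernel_integral_bounds:
  fixes f :: "'t \<Rightarrow> 'o \<Rightarrow> real"
  assumes A: "A \<in> T \<rightarrow>\<^sub>M prob_algebra Out"
    and f01: "\<And>t y. t \<in> space T \<Longrightarrow> y \<in> space Out \<Longrightarrow> f t y \<in> {0..1}"
    and t: "t \<in> space T"
  shows "(\<integral>y. f t y \<partial>A t) \<in> {0..1}"
proof -
  have At: "A t \<in> space (prob_algebra Out)"
    using measurable_space[OF A t] .
  then interpret prob_space "A t"
    by (simp add: space_prob_algebra)
  have sp: "space (A t) = space Out"
    using At by (intro sets_eq_imp_space_eq) (simp add: space_prob_algebra)
  have "0 \<le> (\<integral>y. f t y \<partial>A t)"
    by (rule integral_nonneg_AE) (use f01[OF t] sp in auto)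
  moreover have "(\<integral>y. f t y \<partial>A t) \<le> 1"
  \<comment> \<open>If \<open>f t\<close> is not integrable, its Bochner integral is 0 by
    convention, which also meets the bound.\<close>
  proof (cases "integrable (A t) (f t)")
    case True
    then have "(\<integral>y. f t y \<partial>A t) \<le> (\<integral>y. 1 \<partial>A t)"
      by (rule integral_mono) (use f01[OF t] sp in auto)
    then show ?thesis by (simp add: prob_space)
  qed (simp add: not_integrable_integral_eq)
  ultimately show ?thesis by simp
qed

text \<open>The factor \<open>fail_rate\<close> cancels the normalisation of
  \<open>fail_dist\<close>, leaving the mean of \<psi> (1 - V) under \<open>D\<close>. The detector
  enters only through \<psi>, so it may take any value in the unit interval.\<close>

lemma fail_rate_mean_gap_le:
  fixes r \<phi> :: "'t \<Rightarrow> 'o \<Rightarrow> real"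
  assumes D: "D \<in> space (prob_algebra T)"
    and A: "A \<in> T \<rightarrow>\<^sub>M prob_algebra Out"
    and r: "case_prod r \<in> borel_measurable (T \<Otimes>\<^sub>M Out)"
      "\<And>t y. t \<in> space T \<Longrightarrow> y \<in> space Out \<Longrightarrow> r t y \<in> {0..1}"
    and \<phi>: "case_prod \<phi> \<in> borel_measurable (T \<Otimes>\<^sub>M Out)"
      "\<And>t y. t \<in> space T \<Longrightarrow> y \<in> space Out \<Longrightarrow> \<phi> t y \<in> {0..1}"
    and Z: "fail_rate D \<phi> A > 0"
  shows "fail_rate D \<phi> A * mean_gap D r \<phi> A \<le> 1 - J_user D r A"
proof -
  interpret prob_space D
    using D by (simp add: space_prob_algebra)
  have sets [measurable_cong]: "sets D = sets T"
    using D by (simp add: space_prob_algebra)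
  have sp: "space D = space T"
    using sets by (rule sets_eq_imp_space_eq)
  define V where "V = task_value r A"
  define \<psi> where "\<psi> = fail_prob \<phi> A"
  let ?Z = "fail_rate D \<phi> A"
  have V_meas: "V \<in> borel_measurable T" and \<psi>_meas: "\<psi> \<in> borel_measurable T"
    unfolding V_def \<psi>_def task_value_def fail_prob_def
    by (rule kernel_integral_measurable[OF A r(1)], rule kernel_integral_measurable[OF A \<phi>(1)])
  note [measurable] = V_meas \<psi>_meas
  have V01: "V t \<in> {0..1}" and \<psi>01: "\<psi> t \<in> {0..1}" if "t \<in> space D" for t
    unfolding V_def \<psi>_def task_value_def fail_prob_def
  proof -
    have t: "t \<in> space T"
      using that sp by simp
    show "(\<integral>y. r t y \<partial>A t) \<in> {0..1}"
      by (rule kernel_integral_bounds[OF A r(2) t])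
    show "(\<integral>y. \<phi> t y \<partial>A t) \<in> {0..1}"
      by (rule kernel_integral_bounds[OF A \<phi>(2) t])
  qed
  have int_V: "integrable D V"
    by (rule integrable_const_bound[where B=1]) (use V01 in auto)
  have int_\<psi>: "integrable D \<psi>"
    by (rule integrable_const_bound[where B=1]) (use \<psi>01 in auto)
  have int_\<psi>V: "integrable D (\<lambda>t. \<psi> t * V t)"
    by (rule integrable_const_bound[where B=1])
      (use V01 \<psi>01 in \<open>auto simp: abs_mult mult_le_one\<close>)
  have Z_eq: "?Z = (\<integral>t. \<psi> t \<partial>D)"
    by (simp add: fail_rate_def \<psi>_def)
  \<comment> \<open>Since \<open>?Z\<close> is positive, the density is nonnegative and
    \<open>ennreal\<close> does not truncate it.\<close>
  have "(\<integral>t. V t \<partial>fail_dist D \<phi> A) = (\<integral>t. (\<psi> t / ?Z) * V t \<partial>D)"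
    unfolding fail_dist_def \<psi>_def[symmetric]
    by (subst integral_density) (use Z \<psi>01 in auto)
  also have "\<dots> = (\<integral>t. \<psi> t * V t \<partial>D) / ?Z"
    by simp
  finally have "?Z * mean_gap D r \<phi> A = ?Z - (\<integral>t. \<psi> t * V t \<partial>D)"
    using Z by (simp add: mean_gap_def V_def[symmetric] field_simps)
  also have "\<dots> = (\<integral>t. \<psi> t * (1 - V t) \<partial>D)"
    unfolding Z_eq using int_\<psi> int_\<psi>V by (simp add: right_diff_distrib)
  also have "\<dots> \<le> (\<integral>t. 1 - V t \<partial>D)"
  proof (rule integral_mono)
    show "integrable D (\<lambda>t. \<psi> t * (1 - V t))"
      using int_\<psi> int_\<psi>V by (simp add: right_diff_distrib)
    show "\<psi> t * (1 - V t) \<le> 1 - V t" if "t \<in> space D" for t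
      using V01[OF that] \<psi>01[OF that] by (simp add: mult_left_le_one_le)
  qed (use int_V in simp)
  also have "\<dots> = 1 - J_user D r A"
    using int_V by (simp add: prob_space J_user_def V_def)
  finally show ?thesis .
qed

text \<open>A single label below 1 pulls the average strictly below 1. This makes the denominator
  \<open>1 - Zh\<close> of \<open>eps_D\<close> positive, so that it can be cancelled.\<close>

lemma Z_hat_less_1:
  assumes "\<And>j. \<phi>R j w \<le> 1" and "j < nR w" "\<phi>R j w < 1"
  shows "Z_hat nR \<phi>R w < 1"
proof -
  have "(\<Sum>j<nR w. \<phi>R j w) < (\<Sum>j<nR w. 1)"
    by (rule sum_strict_mono_ex1) (use assms in auto)
  then show ?thesis
    using assms(2) by (simp add: Z_hat_def)
qed

theorem corollary2:
  fixes T :: "'t measure" and Out :: "'o measure"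
    and D :: "'t measure"
    and r \<phi> :: "'t \<Rightarrow> 'o \<Rightarrow> real"
    and Ak At :: "('t, 'o) agent"
    and M :: "'w measure"
    and nR nF :: "'w \<Rightarrow> nat" and m :: nat
    and tR tF :: "nat \<Rightarrow> 'w \<Rightarrow> 't"
    and \<phi>R :: "nat \<Rightarrow> 'w \<Rightarrow> real"
    and Yk Yt :: "nat \<Rightarrow> nat \<Rightarrow> 'w \<Rightarrow> 'o"
    and \<epsilon>V \<epsilon>Z \<epsilon>R \<epsilon>F \<delta> :: real
  assumes user_dist: "D \<in> space (prob_algebra T)"
    and agents: "Ak \<in> T \<rightarrow>\<^sub>M prob_algebra Out" "At \<in> T \<rightarrow>\<^sub>M prob_algebra Out"
    and reward: "case_prod r \<in> borel_measurable (T \<Otimes>\<^sub>M Out)"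
      "\<And>t y. t \<in> space T \<Longrightarrow> y \<in> space Out \<Longrightarrow> r t y \<in> {0..1}"
    and detector: "case_prod \<phi> \<in> borel_measurable (T \<Otimes>\<^sub>M Out)"
      "\<And>t y. t \<in> space T \<Longrightarrow> y \<in> space Out \<Longrightarrow> \<phi> t y \<in> {0, 1}"
    and fail_rate: "fail_rate D \<phi> Ak \<in> {0<..<1}"
    and prob: "prob_space M"
    and stored: "nR \<in> M \<rightarrow>\<^sub>M count_space UNIV" "\<And>j. tR j \<in> M \<rightarrow>\<^sub>M T"
      "\<And>j. \<phi>R j \<in> borel_measurable M" "\<And>j w. w \<in> space M \<Longrightarrow> \<phi>R j w \<in> {0, 1}"
    and batch: "nF \<in> M \<rightarrow>\<^sub>M count_space UNIV" "\<And>i. tF i \<in> M \<rightarrow>\<^sub>M T"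
    and rollouts: "0 < m" "\<And>i l. Yk i l \<in> M \<rightarrow>\<^sub>M Out" "\<And>i l. Yt i l \<in> M \<rightarrow>\<^sub>M Out"
    and radii: "0 < \<epsilon>V" "0 < \<epsilon>Z" "0 < \<epsilon>R" "0 < \<epsilon>F"
    and threshold: "0 < \<delta>"
  shows "\<forall>w \<in> event_L M D r \<phi> Ak At nR \<phi>R nF tF m Yk Yt \<epsilon>V \<epsilon>Z \<epsilon>F.
    (\<exists>\<tau>>0. (\<tau>, \<delta>) \<in> feasible (Z_hat nR \<phi>R w) (fail_rate D \<phi> Ak) (mean_gap D r \<phi> Ak) \<epsilon>V \<epsilon>Z \<epsilon>R \<epsilon>F) \<longrightarrow>
    J_user D r Ak < 1 - (1 - fail_rate D \<phi> Ak) * \<delta> - eps_Sigma \<epsilon>V \<epsilon>Z \<epsilon>R"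
proof (intro ballI impI)
  fix w
  assume w: "w \<in> event_L M D r \<phi> Ak At nR \<phi>R nF tF m Yk Yt \<epsilon>V \<epsilon>Z \<epsilon>F"
  let ?Zh = "Z_hat nR \<phi>R w" and ?Z = "fail_rate D \<phi> Ak"
  let ?S = "eps_Sigma \<epsilon>V \<epsilon>Z \<epsilon>R" and ?ED = "eps_D (Z_hat nR \<phi>R w) \<epsilon>V \<epsilon>Z \<epsilon>R"
  assume "\<exists>\<tau>>0. (\<tau>, \<delta>) \<in> feasible ?Zh ?Z (mean_gap D r \<phi> Ak) \<epsilon>V \<epsilon>Z \<epsilon>R \<epsilon>F"
  \<comment> \<open>Chaining the lower bound on \<open>\<tau>\<close> with the second entry of the
    minimum in \<open>Theta\<close> eliminates \<open>\<tau>\<close>, and \<open>eps_L\<close>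
    cancels on both sides. The strictness of the final bound comes from here.\<close>
  then have feas: "(1 - ?Zh + \<epsilon>Z) * (\<delta> + ?ED) < ?Z * mean_gap D r \<phi> Ak"
    by (auto simp: feasible_def Theta_def)
  from w have w_space: "w \<in> space M" and Zh_close: "\<bar>?Zh - ?Z\<bar> \<le> \<epsilon>Z"
    by (auto simp: event_L_def)
  from w obtain j where j: "j < nR w" "\<phi>R j w = 0"
    by (auto simp: event_L_def)
  have "\<phi>R i w \<le> 1" for i
    using stored(4)[OF w_space, of i] by auto
  then have Zh: "?Zh < 1"
    using j by (intro Z_hat_less_1) auto
  have "0 < ?S"
    using radii by (simp add: eps_Sigma_def)
  then have ED: "0 < ?ED" "(1 - ?Zh) * ?ED = ?S"
    using Zh by (simp_all add: eps_D_def)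
  have "(1 - ?Z) * \<delta> \<le> (1 - ?Zh + \<epsilon>Z) * \<delta>"
    using Zh_close threshold by (intro mult_right_mono) auto
  \<comment> \<open>The part \<open>(1 - ?Zh) * ?ED\<close> is exactly \<open>?S\<close>; the
    surplus \<open>\<epsilon>Z * ?ED\<close> is positive and is dropped.\<close>
  moreover have "?S \<le> (1 - ?Zh + \<epsilon>Z) * ?ED"
    using ED radii by (simp add: distrib_right)
  ultimately have "(1 - ?Z) * \<delta> + ?S \<le> (1 - ?Zh + \<epsilon>Z) * (\<delta> + ?ED)"
    by (simp add: distrib_left)
  also note feas
  also have "?Z * mean_gap D r \<phi> Ak \<le> 1 - J_user D r Ak"
  proof (rule fail_rate_mean_gap_le[OF user_dist agents(1) reward detector(1)])
    show "\<phi> t y \<in> {0..1}" if "t \<in> space T" "y \<in> space Out" for t y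
      using detector(2)[OF that] by auto
  qed (use fail_rate in auto)
  finally show "J_user D r Ak < 1 - (1 - ?Z) * \<delta> - ?S"
    by simp
qed

end
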